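(* Let $DB$ be an uncertain sequence database. For every sequential pattern $\alpha$ of length $m\ge1$ with last item $i_m$, $$expSup^{cap}(\alpha)\ \le\ expSupport^{top}(\alpha),$$ where $expSupport^{top}(\alpha)=maxPr(\alpha_{m-1})\times maxPr(i_m)\times sup_{i_m}$ and $sup_{i_m}$ denotes the support count of $i_m$.
   Context: Fix a finite, totally ordered (lexicographic) set of items $I$. A sequential pattern is a finite sequence $\alpha=\langle X_1,\dots,X_r\rangle$ of nonempty subsets of $I$ (itemsets, or events), each written in increasing item order; its length is $m=\sum_j|X_j|$. Listing the items of $\alpha$ in order as $i_1,\dots,i_m$, let $\alpha_k$ be the pattern formed by the first $k$ items ($\alpha_0$ empty). Thus $\alpha_k$ arises from $\alpha_{k-1}$ either by s-extension ($i_k$ is appended as a new event $\{i_k\}$) or by i-extension ($i_k$ is added to the last event of $\alpha_{k-1}$). An uncertain sequence is a finite sequence of itemsets $S=\langle e_1,\dots,e_n\rangle$ in which every item occurrence carries an existential probability in $(0,1]$. An uncertain sequence database $DB$ is a finite list of uncertain sequences. A pattern $\langle X_1,\dots,X_r\rangle$ occurs in $S$ if there are indices $j_1<\dots<j_r$ with $X_l\subseteq e_{j_l}$ for all $l$; then $S$ is said to contain it. Projected database: for a pattern $\beta$ with last event $X$, $DB|\beta$ consists, for each $S\in DB$ containing $\beta$, of the suffix of $S$ after the leftmost match of $\beta$: with $t$ minimal such that $\beta$ occurs in $\langle e_1,\dots,e_t\rangle$, the suffix consists of the items of $e_t$ that follow the last item of $\beta$, and the events $e_{t+1},\dots,e_n$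 (with their probabilities). $DB|\alpha_0=DB$. An occurrence of an item $i$ in such a suffix is counted as an s-extension of $\beta$ if it lies in one of $e_{t+1},\dots,e_n$, and as an i-extension of $\beta$ if it lies in the remaining part of $e_t$, or in an event $e_j$, $j>t$, with $X\cup\{i\}\subseteq e_j$. When an item $i_k$ is considered in $DB|\alpha_{k-1}$, only occurrences of the extension type by which $\alpha_k$ arises from $\alpha_{k-1}$ are counted. $\widehat P_{DB|\alpha_{k-1}}(i_k)$ is the maximum probability of a counted occurrence of $i_k$ in $DB|\alpha_{k-1}$ ($0$ if none), and for $S\in DB|\alpha_{m-1}$, $maxPr_S(i_m)$ is the maximum probability of a counted occurrence of $i_m$ in that suffix ($0$ if none). Define $$maxPr(\alpha_k)=\prod_{l=1}^{k}\widehat P_{DB|\alpha_{l-1}}(i_l)\quad(maxPr(\alpha_0)=1),\qquad expSup^{cap}(\alpha)=maxPr(\alpha_{m-1})\times\sum_{S\in DB|\alpha_{m-1}}maxPr_S(i_m).$$ For a single item $i$, $maxPr(i)$ is $maxPr$ of the one-item pattern $\langle(i)\rangle$, i.e. the maximum existential probability of $i$ in $DB$ ($0$ if $i$ does not occur), and $sup_i$ is the number of sequences of $DB$ that contain $i$. *)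

theory Defs
  imports Complex_Main
begin

text \<open>Items are taken from a finite set \<open>I\<close> in a linearly ordered type.
  A pattern is a list of itemsets; the empty list is the empty pattern.\<close>

type_synonym 'a pattern = "'a set list"

definition is_pattern :: "'a set \<Rightarrow> 'a pattern \<Rightarrow> bool" where
  "is_pattern I \<alpha> \<longleftrightarrow> (\<forall>X\<in>set \<alpha>. X \<noteq> {} \<and> X \<subseteq> I)"

definition pattern_length :: "'a pattern \<Rightarrow> nat" where
  "pattern_length \<alpha> = (\<Sum>X\<leftarrow>\<alpha>. card X)"

definition pattern_items :: "'a::linorder pattern \<Rightarrow> 'a list" where
  "pattern_items \<alpha> = concat (map sorted_list_of_set \<alpha>)"

text \<open>The items are numbered from 1.\<close>

definition pattern_item :: "'a::linorder pattern \<Rightarrow> nat \<Rightarrow> 'a" where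
  "pattern_item \<alpha> k = pattern_items \<alpha> ! (k - 1)"

text \<open>The pattern formed by the first \<open>k\<close> items.\<close>

fun pattern_prefix :: "'a::linorder pattern \<Rightarrow> nat \<Rightarrow> 'a pattern" where
  "pattern_prefix [] k = []"
| "pattern_prefix (X # Xs) k =
     (if k = 0 then []
      else if k \<le> card X then [set (take k (sorted_list_of_set X))]
      else X # pattern_prefix Xs (k - card X))"

datatype extension = S_Ext | I_Ext

definition extension_type :: "'a::linorder pattern \<Rightarrow> nat \<Rightarrow> extension" where
  "extension_type \<alpha> k =
     (if pattern_prefix \<alpha> k = pattern_prefix \<alpha> (k - 1) @ [{pattern_item \<alpha> k}]
      then S_Ext else I_Ext)"

text \<open>An uncertain event maps each of its items to the existential probability of
  that occurrence; the underlying itemset is the domain of the map.\<close>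

type_synonym 'a uevent = "'a \<Rightarrow> real option"
type_synonym 'a useq = "'a uevent list"

definition is_useq :: "'a set \<Rightarrow> 'a useq \<Rightarrow> bool" where
  "is_useq I S \<longleftrightarrow>
     (\<forall>e\<in>set S. dom e \<noteq> {} \<and> dom e \<subseteq> I \<and> (\<forall>p\<in>ran e. 0 < p \<and> p \<le> 1))"

definition is_udb :: "'a set \<Rightarrow> 'a useq list \<Rightarrow> bool" where
  "is_udb I DB \<longleftrightarrow> (\<forall>S\<in>set DB. is_useq I S)"

definition occurs_in :: "'a pattern \<Rightarrow> 'a useq \<Rightarrow> bool" where
  "occurs_in \<beta> S \<longleftrightarrow>
     (\<exists>js. length js = length \<beta> \<and> sorted_wrt (<) js \<and> (\<forall>j\<in>set js. j < length S) \<and>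
           (\<forall>l<length \<beta>. \<beta> ! l \<subseteq> dom (S ! (js ! l))))"

text \<open>The number of events in the shortest initial segment containing \<open>\<beta>\<close>;
  it is 0 for the empty pattern.\<close>

definition match_end :: "'a pattern \<Rightarrow> 'a useq \<Rightarrow> nat" where
  "match_end \<beta> S = (LEAST t. occurs_in \<beta> (take t S))"

text \<open>A suffix is a pair consisting of what remains of the event in which the leftmost
  match ends and of the later events. Events are 0-indexed in lists, so the former
  event has index \<open>match_end \<beta> S - 1\<close>; for the empty pattern nothing of it remains
  and the suffix is all of \<open>S\<close>.\<close>

type_synonym 'a suffix = "'a uevent \<times> 'a useq"

definition suffix_after :: "'a::linorder pattern \<Rightarrow> 'a useq \<Rightarrow> 'a suffix" where
  "suffix_after \<beta> S =
     (if \<beta> = [] then Map.empty else (S ! (match_end \<beta> S - 1)) |` {i. Max (last \<beta>) < i},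
      drop (match_end \<beta> S) S)"

definition projected_db :: "'a::linorder useq list \<Rightarrow> 'a pattern \<Rightarrow> 'a suffix list" where
  "projected_db DB \<beta> = map (suffix_after \<beta>) (filter (occurs_in \<beta>) DB)"

text \<open>Probabilities of the counted occurrences of \<open>i\<close> in a suffix with respect to \<open>\<beta>\<close>.\<close>

fun counted_probs :: "extension \<Rightarrow> 'a pattern \<Rightarrow> 'a \<Rightarrow> 'a suffix \<Rightarrow> real set" where
  "counted_probs S_Ext \<beta> i (r, es) = {p. \<exists>e\<in>set es. e i = Some p}"
| "counted_probs I_Ext \<beta> i (r, es) =
     {p. r i = Some p} \<union> {p. \<exists>e\<in>set es. last \<beta> \<union> {i} \<subseteq> dom e \<and> e i = Some p}"

definition max_or_zero :: "real set \<Rightarrow> real" where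
  "max_or_zero A = (if A = {} then 0 else Max A)"

definition P_hat :: "'a::linorder useq list \<Rightarrow> 'a pattern \<Rightarrow> nat \<Rightarrow> real" where
  "P_hat DB \<alpha> k =
     (let \<beta> = pattern_prefix \<alpha> (k - 1) in
      max_or_zero (\<Union>\<sigma>\<in>set (projected_db DB \<beta>).
        counted_probs (extension_type \<alpha> k) \<beta> (pattern_item \<alpha> k) \<sigma>))"

definition maxPr :: "'a::linorder useq list \<Rightarrow> 'a pattern \<Rightarrow> real" where
  "maxPr DB \<alpha> = (\<Prod>l = 1..pattern_length \<alpha>. P_hat DB \<alpha> l)"

definition expSup_cap :: "'a::linorder useq list \<Rightarrow> 'a pattern \<Rightarrow> real" where
  "expSup_cap DB \<alpha> =
     (let m = pattern_length \<alpha>; \<beta> = pattern_prefix \<alpha> (m - 1) in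
      maxPr DB \<beta> *
      (\<Sum>\<sigma>\<leftarrow>projected_db DB \<beta>.
         max_or_zero (counted_probs (extension_type \<alpha> m) \<beta> (pattern_item \<alpha> m) \<sigma>)))"

definition maxPr_item :: "'a::linorder useq list \<Rightarrow> 'a \<Rightarrow> real" where
  "maxPr_item DB i = maxPr DB [{i}]"

definition support_item :: "'a useq list \<Rightarrow> 'a \<Rightarrow> nat" where
  "support_item DB i = length (filter (\<lambda>S. \<exists>e\<in>set S. i \<in> dom e) DB)"

definition expSupport_top :: "'a::linorder useq list \<Rightarrow> 'a pattern \<Rightarrow> real" where
  "expSupport_top DB \<alpha> =
     (let m = pattern_length \<alpha>; i = pattern_item \<alpha> m in
      maxPr DB (pattern_prefix \<alpha> (m - 1)) * maxPr_item DB i * real (support_item DB i))"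

end

theory Submission imports Defs begin

text \<open>Every counted occurrence of \<open>i\<close> in a suffix is an occurrence of \<open>i\<close> in the original
  sequence, so its probability is at most \<open>maxPr(i)\<close>, and a sequence without \<open>i\<close> contributes
  \<open>0\<close>. Hence the sum in \<open>expSup\<^sup>c\<^sup>a\<^sup>p\<close> is at most \<open>maxPr(i)\<close> times the support of \<open>i\<close>; the
  common factor \<open>maxPr(\<alpha>\<^sub>m\<^sub>-\<^sub>1)\<close> is nonnegative.\<close>

text \<open>Serves as a superset of \<open>counted_probs\<close> that depends neither on the
  extension type nor on the prefix \<beta>.\<close>

definition item_probs :: "'a \<Rightarrow> 'a useq \<Rightarrow> real set" where
  "item_probs i S = {p. \<exists>e\<in>set S. e i = Some p}"

lemma finite_item_probs: "finite (item_probs i S)"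
proof -
  \<comment> \<open>Only an inclusion: events without \<open>i\<close> contribute an unspecified
    value to the image.\<close>
  have "item_probs i S \<subseteq> (\<lambda>e. the (e i)) ` set S"
    by (auto simp: item_probs_def intro!: rev_image_eqI)
  then show ?thesis by (rule finite_subset) simp
qed

lemma max_or_zero_nonneg:
  assumes "finite A" and "\<And>p. p \<in> A \<Longrightarrow> 0 \<le> p"
  shows "0 \<le> max_or_zero A"
  using assms Max_in[of A] by (auto simp: max_or_zero_def)

text \<open>Nonnegativity of \<open>B\<close> covers the case of empty \<open>A\<close>, where the
  default 0 must not exceed the maximum of \<open>B\<close>.\<close>

lemma max_or_zero_mono:
  assumes "A \<subseteq> B" and "finite B" and "\<And>p. p \<in> B \<Longrightarrow> 0 \<le> p"
  shows "max_or_zero A \<le> max_or_zero B"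
proof (cases "A = {}")
  case True
  then show ?thesis
    using max_or_zero_nonneg[of B] assms by (simp add: max_or_zero_def)
next
  case False
  then show ?thesis
    using assms Max_mono[of A B] by (auto simp: max_or_zero_def)
qed

lemma udb_prob_nonneg:
  assumes "is_udb I DB" and "p \<in> (\<Union>S\<in>set DB. item_probs i S)"
  shows "0 \<le> p"
proof -
  obtain S e where "S \<in> set DB" "e \<in> set S" and "e i = Some p"
    using assms(2) by (auto simp: item_probs_def)
  then have "0 < p"
    using assms(1) unfolding is_udb_def is_useq_def by (blast intro: ranI)
  then show ?thesis by simp
qed

lemma match_event_mem:
  assumes "occurs_in \<beta> S" and "\<beta> \<noteq> []"
  shows "S ! (match_end \<beta> S - 1) \<in> set S"
proof -
  have "match_end \<beta> S \<le> length S"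
    unfolding match_end_def using assms(1) by (intro Least_le) simp
  moreover have "S \<noteq> []"
    using assms by (auto simp: occurs_in_def)
  \<comment> \<open>Positivity of \<open>match_end \<beta> S\<close> is not established here:
    truncated subtraction would turn 0 into the index 0, which is valid because \<open>S\<close> is
    nonempty.\<close>
  ultimately have "match_end \<beta> S - 1 < length S"
    by (cases S) auto
  then show ?thesis by simp
qed

text \<open>Projection creates no new probabilities: the later events are events of
  \<open>S\<close>, and the remainder is either empty or a restriction of the event in which the
  match ends.\<close>

lemma counted_probs_suffix_after_subset:
  assumes "occurs_in \<beta> S"
  shows "counted_probs x \<beta> i (suffix_after \<beta> S) \<subseteq> item_probs i S"
proof (cases x)
  case S_Ext
  then show ?thesis
    by (auto simp: suffix_after_def item_probs_def dest: in_set_dropD)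
next
  case I_Ext
  then show ?thesis
    using match_event_mem[OF assms]
    by (auto simp: suffix_after_def item_probs_def restrict_map_def
        dest: in_set_dropD split: if_splits)
qed

lemma P_hat_nonneg:
  assumes "is_udb I DB"
  shows "0 \<le> P_hat DB \<alpha> k"
proof -
  let ?\<beta> = "pattern_prefix \<alpha> (k - 1)" and ?i = "pattern_item \<alpha> k"
  let ?A = "\<Union>\<sigma>\<in>set (projected_db DB ?\<beta>). counted_probs (extension_type \<alpha> k) ?\<beta> ?i \<sigma>"
  have sub: "?A \<subseteq> (\<Union>S\<in>set DB. item_probs ?i S)"
  proof (rule UN_least)
    fix \<sigma>
    assume "\<sigma> \<in> set (projected_db DB ?\<beta>)"
    then obtain S where "S \<in> set DB" "occurs_in ?\<beta> S" "\<sigma> = suffix_after ?\<beta> S"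
      by (auto simp: projected_db_def)
    with counted_probs_suffix_after_subset[OF this(2)]
    show "counted_probs (extension_type \<alpha> k) ?\<beta> ?i \<sigma> \<subseteq> (\<Union>S\<in>set DB. item_probs ?i S)"
      by (simp only:) (rule SUP_upper2)
  qed
  moreover have "finite (\<Union>S\<in>set DB. item_probs ?i S)"
    by (simp add: finite_item_probs)
  \<comment> \<open>Finiteness ensures that \<open>Max\<close> is an actual element of the set, so
    it inherits the sign of the probabilities.\<close>
  ultimately have "finite ?A" by (rule finite_subset)
  moreover have "0 \<le> p" if "p \<in> ?A" for p
    using assms subsetD[OF sub that] by (rule udb_prob_nonneg)
  ultimately show ?thesis
    unfolding P_hat_def Let_def by (rule max_or_zero_nonneg)
qed

lemma maxPr_nonneg:
  assumes "is_udb I DB"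
  shows "0 \<le> maxPr DB \<alpha>"
  unfolding maxPr_def using P_hat_nonneg[OF assms] by (simp add: prod_nonneg)

lemma match_end_Nil: "match_end [] S = 0"
  unfolding match_end_def by (rule Least_eq_0) (simp add: occurs_in_def)

text \<open>The product has a single factor, an s-extension of the empty pattern. Projecting on that
  pattern keeps every event, so every occurrence of \<open>i\<close> is counted.\<close>

lemma maxPr_item_eq: "maxPr_item DB i = max_or_zero (\<Union>S\<in>set DB. item_probs i S)"
proof -
  have "extension_type [{i}] 1 = S_Ext" and "pattern_item [{i}] 1 = i"
    by (simp_all add: extension_type_def pattern_item_def pattern_items_def)
  moreover have "projected_db DB [] = map (\<lambda>S. (Map.empty, S)) DB"
    by (induction DB) (simp_all add: projected_db_def suffix_after_def match_end_Nil occurs_in_def)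
  ultimately show ?thesis
    by (simp add: maxPr_item_def maxPr_def pattern_length_def P_hat_def item_probs_def)
qed

text \<open>The bound \<open>M\<close> is kept abstract because it has to stay fixed while the
  induction shortens \<open>DB\<close>, whereas \<open>maxPr_item DB i\<close> would change with the
  list.\<close>

lemma sum_projected_db_le:
  assumes "\<And>S. S \<in> set DB \<Longrightarrow> occurs_in \<beta> S \<Longrightarrow>
             f (suffix_after \<beta> S) \<le> (if \<exists>e\<in>set S. i \<in> dom e then M else 0)"
    and "0 \<le> M"
  shows "(\<Sum>\<sigma>\<leftarrow>projected_db DB \<beta>. f \<sigma>) \<le> M * real (support_item DB i)"
  using assms(1)
proof (induction DB)
  case Nil
  then show ?case by (simp add: projected_db_def support_item_def)
next
  case (Cons S DB)
  have IH: "(\<Sum>\<sigma>\<leftarrow>projected_db DB \<beta>. f \<sigma>) \<le> M * real (support_item DB i)"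
    using Cons by simp
  have "(\<Sum>\<sigma>\<leftarrow>projected_db (S # DB) \<beta>. f \<sigma>) =
      (if occurs_in \<beta> S then f (suffix_after \<beta> S) else 0) + (\<Sum>\<sigma>\<leftarrow>projected_db DB \<beta>. f \<sigma>)"
    by (simp add: projected_db_def)
  also have "\<dots> \<le> (if \<exists>e\<in>set S. i \<in> dom e then M else 0) + M * real (support_item DB i)"
  proof (rule add_mono)
    \<comment> \<open>A sequence that contains \<open>i\<close> but not \<beta> adds to the support
      and not to the sum; \<open>0 \<le> M\<close> absorbs this.\<close>
    show "(if occurs_in \<beta> S then f (suffix_after \<beta> S) else 0)
        \<le> (if \<exists>e\<in>set S. i \<in> dom e then M else 0)"
      using Cons.prems[of S] assms(2) by (cases "occurs_in \<beta> S") (simp_all del: domIff)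
  qed (rule IH)
  also have "\<dots> = M * real (support_item (S # DB) i)"
    by (simp add: support_item_def algebra_simps)
  finally show ?case .
qed

theorem lemma2:
  fixes I :: "'a::linorder set" and DB :: "'a useq list" and \<alpha> :: "'a pattern"
  assumes "finite I"
    and "is_udb I DB"
    and "is_pattern I \<alpha>"
    and "pattern_length \<alpha> \<ge> 1"
  shows "expSup_cap DB \<alpha> \<le> expSupport_top DB \<alpha>"
proof -
  define m where "m = pattern_length \<alpha>"
  define \<beta> where "\<beta> = pattern_prefix \<alpha> (m - 1)"
  define i where "i = pattern_item \<alpha> m"
  let ?f = "\<lambda>\<sigma>. max_or_zero (counted_probs (extension_type \<alpha> m) \<beta> i \<sigma>)"
  have "?f (suffix_after \<beta> S) \<le> (if \<exists>e\<in>set S. i \<in> dom e then maxPr_item DB i else 0)"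
    if S: "S \<in> set DB" "occurs_in \<beta> S" for S
  proof -
    have sub: "counted_probs (extension_type \<alpha> m) \<beta> i (suffix_after \<beta> S) \<subseteq> item_probs i S"
      using S(2) by (rule counted_probs_suffix_after_subset)
    show ?thesis
    proof (cases "\<exists>e\<in>set S. i \<in> dom e")
      case True
      have "?f (suffix_after \<beta> S) \<le> max_or_zero (\<Union>S\<in>set DB. item_probs i S)"
      proof (rule max_or_zero_mono)
        show "counted_probs (extension_type \<alpha> m) \<beta> i (suffix_after \<beta> S)
            \<subseteq> (\<Union>S\<in>set DB. item_probs i S)"
          using sub S(1) by blast
        show "finite (\<Union>S\<in>set DB. item_probs i S)"
          by (simp add: finite_item_probs)
        show "0 \<le> p" if "p \<in> (\<Union>S\<in>set DB. item_probs i S)" for p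
          using assms(2) that by (rule udb_prob_nonneg)
      qed
      with True show ?thesis by (simp add: maxPr_item_eq)
    next
      case False
      \<comment> \<open>No occurrence is left to count, so \<open>max_or_zero\<close> takes its
        default 0, exactly the bound required.\<close>
      then have "item_probs i S = {}" by (auto simp: item_probs_def)
      with sub False show ?thesis by (simp add: max_or_zero_def)
    qed
  qed
  moreover have "0 \<le> maxPr_item DB i"
    unfolding maxPr_item_def using assms(2) by (rule maxPr_nonneg)
  ultimately have "(\<Sum>\<sigma>\<leftarrow>projected_db DB \<beta>. ?f \<sigma>) \<le> maxPr_item DB i * real (support_item DB i)"
    by (rule sum_projected_db_le)
  then have "maxPr DB \<beta> * (\<Sum>\<sigma>\<leftarrow>projected_db DB \<beta>. ?f \<sigma>)
      \<le> maxPr DB \<beta> * (maxPr_item DB i * real (support_item DB i))"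
    using maxPr_nonneg[OF assms(2)] by (rule mult_left_mono)
  then show ?thesis
    by (simp add: expSup_cap_def expSupport_top_def Let_def m_def \<beta>_def i_def mult.assoc)
qed

end
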